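(* Let $X$ be a lattice-ordered group and let $R$ be an internal equivalence relation on $X$ in the category $\ell\mathbb{G}rp$ of lattice-ordered groups. Then the centralizer of $R$ exists and is equal to $\varphi^{-1}(I_R^{\perp})$, i.e. it is the internal equivalence relation on $X$ whose associated ideal is the polar $I_R^{\perp}$ of the ideal $I_R=\{x\in X \mid (x,e)\in R\}$.
   Context: A lattice-ordered group is an algebra $(X,\cdot,e,(-)^{-1},\lor)$ such that $(X,\cdot,e,(-)^{-1})$ is a group, $(X,\lor)$ is a semilattice ($\lor$ is associative, commutative, idempotent), and $x(y\lor z)=xy\lor xz$, $(x\lor y)z=xz\lor yz$ for all $x,y,z$. Morphisms are the maps preserving the group product and $\lor$; this defines the category $\ell\mathbb{G}rp$. One sets $x\land y := (x^{-1}\lor y^{-1})^{-1}$ and $|x| := x\lor x^{-1}$. For a non-empty subset $S\subseteq X$, the polar is $S^{\perp} := \{x\in X \mid |x|\land|s|=e \text{ for each } s\in S\}$. An ideal of $X$ is a subobject that is the kernel of some morphism (equivalently, a convex subalgebra that is normal as a subgroup); the polar of an ideal is an ideal. Internal equivalence relations on $X$ are the equivalence relations $R\subseteq X\times X$ that are subalgebras of $X\times X$. There is an order-preserving bijection $\varphi$ from the lattice of internal equivalence relations on $X$ to the lattice of ideals of $X$, given by $\varphi(R)=I_R := \{x\in X\mid (x,e)\in R\}$. Given internal equivalence relations $R$ and $S$ on $X$, with projections $r_1,r_2\colon R\to X$, $s_1,s_2\colon S\to X$ and diagonals $\delta_R\colon X\to R$, $\delta_S\colon X\to S$, let $R\times_X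 S$ be the pullback of $r_2$ and $s_1$, and let $\tau_R=(id_R,\delta_S r_2)\colon R\to R\times_X S$ and $\tau_S=(\delta_R s_1,id_S)\colon S\to R\times_X S$. $R$ and $S$ commute in the Smith-Pedicchio sense if there is a (unique) morphism $p\colon R\times_X S\to X$ with $p\tau_S=s_2$ and $p\tau_R=r_1$. The centralizer of $R$ is the greatest internal equivalence relation on $X$ that commutes with $R$ in this sense. *)

theory Defs
  imports "HOL-Algebra.Group"
begin

record 'a lgroup = "'a monoid" +
  ljoin :: "['a, 'a] \<Rightarrow> 'a"  (infixl \<open>\<squnion>\<^sub>\<ell>\<index>\<close> 65)

locale lattice_ordered_group = group X for X (structure) +
  assumes ljoin_closed: "\<lbrakk>x \<in> carrier X; y \<in> carrier X\<rbrakk> \<Longrightarrow> x \<squnion>\<^sub>\<ell> y \<in> carrier X"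
    and ljoin_assoc: "\<lbrakk>x \<in> carrier X; y \<in> carrier X; z \<in> carrier X\<rbrakk> \<Longrightarrow>
      (x \<squnion>\<^sub>\<ell> y) \<squnion>\<^sub>\<ell> z = x \<squnion>\<^sub>\<ell> (y \<squnion>\<^sub>\<ell> z)"
    and ljoin_comm: "\<lbrakk>x \<in> carrier X; y \<in> carrier X\<rbrakk> \<Longrightarrow> x \<squnion>\<^sub>\<ell> y = y \<squnion>\<^sub>\<ell> x"
    and ljoin_idem: "x \<in> carrier X \<Longrightarrow> x \<squnion>\<^sub>\<ell> x = x"
    and mult_ljoin_distrib: "\<lbrakk>x \<in> carrier X; y \<in> carrier X; z \<in> carrier X\<rbrakk> \<Longrightarrow>
      x \<otimes> (y \<squnion>\<^sub>\<ell> z) = (x \<otimes> y) \<squnion>\<^sub>\<ell> (x \<otimes> z)"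
    and ljoin_mult_distrib: "\<lbrakk>x \<in> carrier X; y \<in> carrier X; z \<in> carrier X\<rbrakk> \<Longrightarrow>
      (x \<squnion>\<^sub>\<ell> y) \<otimes> z = (x \<otimes> z) \<squnion>\<^sub>\<ell> (y \<otimes> z)"

definition lmeet :: "('a, 'm) lgroup_scheme \<Rightarrow> 'a \<Rightarrow> 'a \<Rightarrow> 'a" where
  "lmeet X x y = inv\<^bsub>X\<^esub> (inv\<^bsub>X\<^esub> x \<squnion>\<^sub>\<ell>\<^bsub>X\<^esub> inv\<^bsub>X\<^esub> y)"

definition labs :: "('a, 'm) lgroup_scheme \<Rightarrow> 'a \<Rightarrow> 'a" where
  "labs X x = x \<squnion>\<^sub>\<ell>\<^bsub>X\<^esub> inv\<^bsub>X\<^esub> x"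

definition polar :: "('a, 'm) lgroup_scheme \<Rightarrow> 'a set \<Rightarrow> 'a set" where
  "polar X S = {x \<in> carrier X. \<forall>s\<in>S. lmeet X (labs X x) (labs X s) = \<one>\<^bsub>X\<^esub>}"

(* Morphisms are extensional, so that equality of HOL functions is equality of morphisms
   and uniqueness of a morphism can be expressed. *)
definition lgroup_hom ::
  "('a, 'm) lgroup_scheme \<Rightarrow> ('b, 'n) lgroup_scheme \<Rightarrow> ('a \<Rightarrow> 'b) set" where
  "lgroup_hom X Y = {f \<in> hom X Y \<inter> extensional (carrier X).
     \<forall>x\<in>carrier X. \<forall>y\<in>carrier X. f (x \<squnion>\<^sub>\<ell>\<^bsub>X\<^esub> y) = f x \<squnion>\<^sub>\<ell>\<^bsub>Y\<^esub> f y}"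

definition lgroup_prod ::
  "('a, 'm) lgroup_scheme \<Rightarrow> ('b, 'n) lgroup_scheme \<Rightarrow> ('a \<times> 'b) lgroup" (infixr \<open>\<times>\<^sub>\<ell>\<close> 80) where
  "X \<times>\<^sub>\<ell> Y =
    \<lparr>carrier = carrier X \<times> carrier Y,
     mult = (\<lambda>(x, y) (x', y'). (x \<otimes>\<^bsub>X\<^esub> x', y \<otimes>\<^bsub>Y\<^esub> y')),
     one = (\<one>\<^bsub>X\<^esub>, \<one>\<^bsub>Y\<^esub>),
     ljoin = (\<lambda>(x, y) (x', y'). (x \<squnion>\<^sub>\<ell>\<^bsub>X\<^esub> x', y \<squnion>\<^sub>\<ell>\<^bsub>Y\<^esub> y'))\<rparr>"

definition lsubalgebra :: "'a set \<Rightarrow> ('a, 'm) lgroup_scheme \<Rightarrow> bool" where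
  "lsubalgebra H X \<longleftrightarrow> subgroup H X \<and> (\<forall>x\<in>H. \<forall>y\<in>H. x \<squnion>\<^sub>\<ell>\<^bsub>X\<^esub> y \<in> H)"

definition internal_equivs :: "('a, 'm) lgroup_scheme \<Rightarrow> ('a \<times> 'a) set set" where
  "internal_equivs X = {R. equiv (carrier X) R \<and> lsubalgebra R (X \<times>\<^sub>\<ell> X)}"

definition assoc_ideal :: "('a, 'm) lgroup_scheme \<Rightarrow> ('a \<times> 'a) set \<Rightarrow> 'a set" where
  "assoc_ideal X R = {x \<in> carrier X. (x, \<one>\<^bsub>X\<^esub>) \<in> R}"

definition assoc_ideal_inv :: "('a, 'm) lgroup_scheme \<Rightarrow> 'a set \<Rightarrow> ('a \<times> 'a) set" where
  "assoc_ideal_inv X = the_inv_into (internal_equivs X) (assoc_ideal X)"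

definition rel_lgroup :: "('a, 'm) lgroup_scheme \<Rightarrow> ('a \<times> 'a) set \<Rightarrow> ('a \<times> 'a) lgroup" where
  "rel_lgroup X R = (X \<times>\<^sub>\<ell> X)\<lparr>carrier := R\<rparr>"

definition lgroup_pullback ::
  "('a, 'm) lgroup_scheme \<Rightarrow> ('b, 'n) lgroup_scheme \<Rightarrow> ('a \<Rightarrow> 'c) \<Rightarrow> ('b \<Rightarrow> 'c) \<Rightarrow> ('a \<times> 'b) lgroup" where
  "lgroup_pullback A B f g =
     (A \<times>\<^sub>\<ell> B)\<lparr>carrier := {(a, b). a \<in> carrier A \<and> b \<in> carrier B \<and> f a = g b}\<rparr>"

(* With projections r1 = s1 = fst, r2 = s2 = snd and diagonals x |-> (x, x), an element of the
   pullback of r2 and s1 is a pair ((x, y), (y, z)) with (x, y) in R and (y, z) in S. *)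
definition smith_pedicchio_commute ::
  "('a, 'm) lgroup_scheme \<Rightarrow> ('a \<times> 'a) set \<Rightarrow> ('a \<times> 'a) set \<Rightarrow> bool" where
  "smith_pedicchio_commute X R S \<longleftrightarrow>
     (\<exists>!p. p \<in> lgroup_hom (lgroup_pullback (rel_lgroup X R) (rel_lgroup X S) snd fst) X \<and>
           (\<forall>s\<in>S. p ((fst s, fst s), s) = snd s) \<and>
           (\<forall>r\<in>R. p (r, (snd r, snd r)) = fst r))"

definition is_centralizer ::
  "('a, 'm) lgroup_scheme \<Rightarrow> ('a \<times> 'a) set \<Rightarrow> ('a \<times> 'a) set \<Rightarrow> bool" where
  "is_centralizer X R C \<longleftrightarrow>
     C \<in> internal_equivs X \<and> smith_pedicchio_commute X R C \<and>
     (\<forall>S \<in> internal_equivs X. smith_pedicchio_commute X R S \<longrightarrow> S \<subseteq> C)"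

end

(* With I = assoc_ideal X R and J its polar, the candidate centralizer is the congruence C modulo J.
   The map sending ((x, y), (y, z)) to x y^-1 z is congruent to z modulo I and to x modulo J, so
   it preserves every operation modulo I and modulo J, hence exactly, since I and J meet
   trivially. Conversely, if S commutes with R and a, b are positive elements of the ideals of R
   and S, comparing p ((a, e), (e, b)) with the join of p ((a, e), (e, e)) and p ((e, e), (e, b))
   gives a b = a \<squnion> b = a (a^-1 \<squnion> b^-1) b, so the meet of a and b is e. *)
theory Submission
  imports Defs
begin

context lattice_ordered_group
begin

section \<open>The order induced by the join, with \<open>lmeet\<close> as greatest lower
  bound\<close>

definition le :: "'a \<Rightarrow> 'a \<Rightarrow> bool"  (infix \<open>\<preceq>\<close> 50) where
  "x \<preceq> y \<longleftrightarrow> x \<squnion>\<^sub>\<ell> y = y"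

lemma le_refl: "x \<in> carrier X \<Longrightarrow> x \<preceq> x"
  by (simp add: le_def ljoin_idem)

lemma le_trans:
  assumes "x \<preceq> y" "y \<preceq> z" "x \<in> carrier X" "y \<in> carrier X" "z \<in> carrier X"
  shows "x \<preceq> z"
  using assms by (metis le_def ljoin_assoc)

lemma le_antisym:
  assumes "x \<preceq> y" "y \<preceq> x" "x \<in> carrier X" "y \<in> carrier X"
  shows "x = y"
  using assms by (metis le_def ljoin_comm)

lemma ljoin_ub1: "\<lbrakk>x \<in> carrier X; y \<in> carrier X\<rbrakk> \<Longrightarrow> x \<preceq> x \<squnion>\<^sub>\<ell> y"
  by (metis le_def ljoin_assoc ljoin_idem)

lemma ljoin_ub2: "\<lbrakk>x \<in> carrier X; y \<in> carrier X\<rbrakk> \<Longrightarrow> y \<preceq> x \<squnion>\<^sub>\<ell> y"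
  by (metis ljoin_ub1 ljoin_comm)

lemma ljoin_least:
  assumes "x \<preceq> z" "y \<preceq> z" "x \<in> carrier X" "y \<in> carrier X" "z \<in> carrier X"
  shows "x \<squnion>\<^sub>\<ell> y \<preceq> z"
  using assms by (metis le_def ljoin_assoc)

lemma le_mult_left:
  assumes "x \<preceq> y" "x \<in> carrier X" "y \<in> carrier X" "z \<in> carrier X"
  shows "z \<otimes> x \<preceq> z \<otimes> y"
  using assms by (metis le_def mult_ljoin_distrib)

lemma le_mult_right:
  assumes "x \<preceq> y" "x \<in> carrier X" "y \<in> carrier X" "z \<in> carrier X"
  shows "x \<otimes> z \<preceq> y \<otimes> z"
  using assms by (metis le_def ljoin_mult_distrib)

lemma le_mult_mono:
  assumes "x \<preceq> y" "u \<preceq> v" "x \<in> carrier X" "y \<in> carrier X" "u \<in> carrier X" "v \<in> carrier X"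
  shows "x \<otimes> u \<preceq> y \<otimes> v"
  using assms by (meson le_mult_left le_mult_right le_trans m_closed)

lemma le_inv:
  assumes "x \<preceq> y" "x \<in> carrier X" "y \<in> carrier X"
  shows "inv y \<preceq> inv x"
proof -
  have "inv x \<otimes> x \<otimes> inv y \<preceq> inv x \<otimes> y \<otimes> inv y"
    using assms by (intro le_mult_left le_mult_right) auto
  then show ?thesis using assms by (simp add: m_assoc)
qed

lemma le_inv_swap:
  assumes "x \<preceq> inv y" "x \<in> carrier X" "y \<in> carrier X"
  shows "y \<preceq> inv x"
  using le_inv[OF assms(1)] assms by simp

lemma lmeet_closed: "\<lbrakk>x \<in> carrier X; y \<in> carrier X\<rbrakk> \<Longrightarrow> lmeet X x y \<in> carrier X"
  by (simp add: lmeet_def ljoin_closed)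

lemma lmeet_lb1: "\<lbrakk>x \<in> carrier X; y \<in> carrier X\<rbrakk> \<Longrightarrow> lmeet X x y \<preceq> x"
  using le_inv[OF ljoin_ub1[of "inv x" "inv y"]] by (simp add: lmeet_def ljoin_closed)

lemma lmeet_lb2: "\<lbrakk>x \<in> carrier X; y \<in> carrier X\<rbrakk> \<Longrightarrow> lmeet X x y \<preceq> y"
  using le_inv[OF ljoin_ub2[of "inv x" "inv y"]] by (simp add: lmeet_def ljoin_closed)

lemma lmeet_greatest:
  assumes "z \<preceq> x" "z \<preceq> y" "x \<in> carrier X" "y \<in> carrier X" "z \<in> carrier X"
  shows "z \<preceq> lmeet X x y"
proof -
  have "inv x \<squnion>\<^sub>\<ell> inv y \<preceq> inv z" using assms by (simp add: ljoin_least le_inv)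
  then show ?thesis using assms by (simp add: lmeet_def le_inv_swap ljoin_closed)
qed

lemma lmeet_idem: "x \<in> carrier X \<Longrightarrow> lmeet X x x = x"
  by (simp add: lmeet_def ljoin_idem)

section \<open>Absolute values\<close>

lemma labs_closed: "x \<in> carrier X \<Longrightarrow> labs X x \<in> carrier X"
  by (simp add: labs_def ljoin_closed)

lemma labs_inv: "x \<in> carrier X \<Longrightarrow> labs X (inv x) = labs X x"
  by (simp add: labs_def ljoin_comm)

lemma le_labs: "x \<in> carrier X \<Longrightarrow> x \<preceq> labs X x"
  by (simp add: labs_def ljoin_ub1)

lemma inv_le_labs: "x \<in> carrier X \<Longrightarrow> inv x \<preceq> labs X x"
  by (simp add: labs_def ljoin_ub2)

text \<open>The element h, the join of g and e, is idempotent: \<open>h h\<close> is the join of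
  \<open>g h\<close> and h, and \<open>g h\<close>, being the join of \<open>g g\<close> and g, lies
  below h. In a group this forces h = e, that is, g lies below e.\<close>

lemma square_le_one:
  assumes g: "g \<in> carrier X" and le: "g \<otimes> g \<preceq> \<one>"
  shows "g \<preceq> \<one>"
proof -
  define h where "h = g \<squnion>\<^sub>\<ell> \<one>"
  have h: "h \<in> carrier X" using g by (simp add: h_def ljoin_closed)
  have 1: "\<one> \<preceq> h" "g \<preceq> h" using g by (simp_all add: h_def ljoin_ub1 ljoin_ub2)
  have "g \<otimes> g \<preceq> h" using le 1 g h by (meson le_trans m_closed one_closed)
  then have "g \<otimes> h \<preceq> h"
    using g 1 h by (simp add: h_def mult_ljoin_distrib ljoin_least)
  moreover have "h \<otimes> h = g \<otimes> h \<squnion>\<^sub>\<ell> h"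
    using ljoin_mult_distrib[of g \<one> h] g h by (simp add: h_def)
  ultimately have "h \<otimes> h = h" by (simp add: le_def)
  then have "h = \<one>" using h by simp
  then show ?thesis using 1 by simp
qed

text \<open>Both x and \<open>inv x\<close> lie below the absolute value, so e lies below its
  square. Inverting turns this into the hypothesis of \<open>square_le_one\<close> for the inverse
  of the absolute value, and a second inversion finishes.\<close>

lemma one_le_labs:
  assumes x: "x \<in> carrier X"
  shows "\<one> \<preceq> labs X x"
proof -
  let ?a = "labs X x"
  have a: "?a \<in> carrier X" using x by (rule labs_closed)
  have "x \<otimes> inv x \<preceq> ?a \<otimes> ?a"
    using x a by (intro le_mult_mono le_labs inv_le_labs) auto
  then have "\<one> \<preceq> ?a \<otimes> ?a" using x by simp
  then have "inv (?a \<otimes> ?a) \<preceq> inv \<one>" using a by (intro le_inv) auto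
  then have "inv ?a \<otimes> inv ?a \<preceq> \<one>" using a by (simp add: inv_mult_group)
  then have "inv ?a \<preceq> inv \<one>" using square_le_one[of "inv ?a"] a by simp
  then show ?thesis using le_inv_swap[of "inv ?a" "\<one>"] a by simp
qed

lemma labs_le:
  assumes "x \<preceq> c" "inv x \<preceq> c" "x \<in> carrier X" "c \<in> carrier X"
  shows "labs X x \<preceq> c"
  unfolding labs_def using assms by (intro ljoin_least) auto

text \<open>Lets the absolute value be dropped from the polar condition on positive
  elements.\<close>

lemma labs_of_ge_one:
  assumes "\<one> \<preceq> c" "c \<in> carrier X"
  shows "labs X c = c"
proof (rule le_antisym)
  have "inv c \<preceq> \<one>" using le_inv[OF assms(1)] assms by simp
  then have "inv c \<preceq> c" using assms by (meson inv_closed le_trans one_closed)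
  then show "labs X c \<preceq> c" using assms by (simp add: labs_le le_refl)
qed (use assms in \<open>auto simp: le_labs labs_closed\<close>)

lemma labs_eq_one:
  assumes "labs X x = \<one>" "x \<in> carrier X"
  shows "x = \<one>"
proof (rule le_antisym)
  show "x \<preceq> \<one>" using le_labs[of x] assms by simp
  show "\<one> \<preceq> x" using le_inv[OF inv_le_labs[of x]] assms by simp
qed (use assms in auto)

text \<open>Without commutativity, |x| |y| bounds \<open>x y\<close> whereas |y| |x| bounds its
  inverse. The third factor makes one element dominate both, since an extra positive factor on
  either side only enlarges a product.\<close>

lemma mult_le_labs_mult_labs:
  assumes "x \<in> carrier X" "y \<in> carrier X"
  shows "labs X (x \<otimes> y) \<preceq> labs X x \<otimes> labs X y \<otimes> labs X x"
proof -
  let ?a = "labs X x" and ?b = "labs X y"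
  have ab: "?a \<in> carrier X" "?b \<in> carrier X" using assms by (auto simp: labs_closed)
  have "(x \<otimes> y) \<otimes> \<one> \<preceq> (?a \<otimes> ?b) \<otimes> ?a"
    using assms ab by (intro le_mult_mono le_labs one_le_labs) auto
  moreover have "\<one> \<otimes> (inv y \<otimes> inv x) \<preceq> ?a \<otimes> (?b \<otimes> ?a)"
    using assms ab by (intro le_mult_mono inv_le_labs one_le_labs) auto
  ultimately show ?thesis
    using assms ab by (intro labs_le) (auto simp: inv_mult_group m_assoc)
qed

section \<open>Conjugation, and pairs of elements whose meet is the identity\<close>

lemma conj_ljoin:
  assumes "g \<in> carrier X" "x \<in> carrier X" "y \<in> carrier X"
  shows "g \<otimes> (x \<squnion>\<^sub>\<ell> y) \<otimes> inv g = (g \<otimes> x \<otimes> inv g) \<squnion>\<^sub>\<ell> (g \<otimes> y \<otimes> inv g)"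
  using assms by (simp add: mult_ljoin_distrib ljoin_mult_distrib)

lemma conj_inv:
  assumes "g \<in> carrier X" "x \<in> carrier X"
  shows "inv (g \<otimes> x \<otimes> inv g) = g \<otimes> inv x \<otimes> inv g"
  using assms by (simp add: inv_mult_group m_assoc)

lemma conj_labs:
  assumes "g \<in> carrier X" "x \<in> carrier X"
  shows "labs X (g \<otimes> x \<otimes> inv g) = g \<otimes> labs X x \<otimes> inv g"
  using assms by (simp add: labs_def conj_ljoin conj_inv)

text \<open>Together with \<open>conj_labs\<close>, this lets conjugation transport the condition
  |x| meet |s| = e, which yields normality of polars.\<close>

lemma conj_lmeet:
  assumes "g \<in> carrier X" "x \<in> carrier X" "y \<in> carrier X"
  shows "lmeet X (g \<otimes> x \<otimes> inv g) (g \<otimes> y \<otimes> inv g) = g \<otimes> lmeet X x y \<otimes> inv g"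
  using assms by (simp add: lmeet_def conj_ljoin[symmetric] conj_inv ljoin_closed)

text \<open>Let m be the meet of \<open>a b\<close> and c. Then \<open>a^-1 m\<close> lies below b,
  and also below c because \<open>a^-1\<close> lies below e. Hence it lies below the meet of b and
  c, which is e. So m lies below a as well as c, hence below e.\<close>

lemma lmeet_mult_eq_one:
  assumes "lmeet X a c = \<one>" "lmeet X b c = \<one>" "\<one> \<preceq> a" "\<one> \<preceq> b" "\<one> \<preceq> c"
    and car: "a \<in> carrier X" "b \<in> carrier X" "c \<in> carrier X"
  shows "lmeet X (a \<otimes> b) c = \<one>"
proof (rule le_antisym)
  let ?m = "lmeet X (a \<otimes> b) c"
  show m: "?m \<in> carrier X" using car by (simp add: lmeet_closed)
  have mc: "?m \<preceq> c" using car by (simp add: lmeet_lb2)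
  have "?m \<preceq> a \<otimes> b" using car by (simp add: lmeet_lb1)
  then have "inv a \<otimes> ?m \<preceq> inv a \<otimes> (a \<otimes> b)" using car m by (intro le_mult_left) auto
  then have 1: "inv a \<otimes> ?m \<preceq> b" using car by (simp add: m_assoc[symmetric])
  have "inv a \<preceq> \<one>" using le_inv[OF assms(3)] car by simp
  then have "inv a \<otimes> ?m \<preceq> \<one> \<otimes> c" using mc m car by (intro le_mult_mono) auto
  then have "inv a \<otimes> ?m \<preceq> lmeet X b c" using 1 car m by (intro lmeet_greatest) auto
  then have "a \<otimes> (inv a \<otimes> ?m) \<preceq> a \<otimes> \<one>" using assms m by (intro le_mult_left) auto
  then have "?m \<preceq> a" using car m by (simp add: m_assoc[symmetric])
  then have "?m \<preceq> lmeet X a c" using mc car m by (intro lmeet_greatest) auto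
  then show "?m \<preceq> \<one>" using assms by simp
  have "\<one> \<otimes> \<one> \<preceq> a \<otimes> b" using assms by (intro le_mult_mono) auto
  then show "\<one> \<preceq> ?m" using assms by (intro lmeet_greatest) auto
qed simp

lemma lmeet_eq_one_mono:
  assumes "lmeet X a c = \<one>" "b \<preceq> a" "\<one> \<preceq> b" "\<one> \<preceq> c"
    and car: "a \<in> carrier X" "b \<in> carrier X" "c \<in> carrier X"
  shows "lmeet X b c = \<one>"
proof (rule le_antisym)
  have "lmeet X b c \<preceq> b" "lmeet X b c \<preceq> c" using car by (auto simp: lmeet_lb1 lmeet_lb2)
  then have "lmeet X b c \<preceq> lmeet X a c"
    using assms by (meson le_trans lmeet_closed lmeet_greatest)
  then show "lmeet X b c \<preceq> \<one>" using assms by simp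
  show "\<one> \<preceq> lmeet X b c" using assms by (intro lmeet_greatest) auto
qed (use car in \<open>auto simp: lmeet_closed\<close>)

lemma lmeet_eq_one_if_mult_eq_ljoin:
  assumes "a \<otimes> b = a \<squnion>\<^sub>\<ell> b" and car: "a \<in> carrier X" "b \<in> carrier X"
  shows "lmeet X a b = \<one>"
proof -
  let ?j = "inv a \<squnion>\<^sub>\<ell> inv b"
  have j: "?j \<in> carrier X" using car by (simp add: ljoin_closed)
  have "a \<otimes> ?j \<otimes> b = b \<squnion>\<^sub>\<ell> a"
    using car by (simp add: mult_ljoin_distrib ljoin_mult_distrib m_assoc)
  also have "\<dots> = a \<otimes> b" using assms by (simp add: ljoin_comm)
  finally have "?j = \<one>" using car j by simp
  then show ?thesis by (simp add: lmeet_def)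
qed

section \<open>Polars: convexity, subgroup properties, normality, compatibility with joins\<close>

lemma polar_closed: "x \<in> polar X S \<Longrightarrow> x \<in> carrier X"
  by (simp add: polar_def)

text \<open>Convexity of the polar in the form used below: bounding x and its inverse by c bounds
  |x| by c, and a meet with |s| that is e for c remains e for the smaller positive element
  |x|.\<close>

lemma polarI_le:
  assumes c: "c \<in> polar X S" "\<one> \<preceq> c" and x: "x \<preceq> c" "inv x \<preceq> c" "x \<in> carrier X"
    and S: "S \<subseteq> carrier X"
  shows "x \<in> polar X S"
proof -
  have cc: "c \<in> carrier X" using c by (simp add: polar_def)
  have "lmeet X (labs X x) (labs X s) = \<one>" if "s \<in> S" for s
  proof (rule lmeet_eq_one_mono)
    show "lmeet X c (labs X s) = \<one>"
      using c that cc by (simp add: polar_def labs_of_ge_one)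
    show "labs X x \<preceq> c" using x cc by (simp add: labs_le)
  qed (use that S x cc in \<open>auto simp: one_le_labs labs_closed\<close>)
  then show ?thesis using x by (simp add: polar_def)
qed

lemma polar_labs:
  assumes "x \<in> polar X S"
  shows "labs X x \<in> polar X S"
  using assms by (simp add: polar_def labs_closed labs_of_ge_one one_le_labs)

text \<open>The positive case of closure under products, where elements are their own absolute
  values and \<open>lmeet_mult_eq_one\<close> applies directly.\<close>

lemma polar_mult_ge_one:
  assumes "c \<in> polar X S" "d \<in> polar X S" "\<one> \<preceq> c" "\<one> \<preceq> d" "S \<subseteq> carrier X"
  shows "c \<otimes> d \<in> polar X S" "\<one> \<preceq> c \<otimes> d"
proof -
  have cd: "c \<in> carrier X" "d \<in> carrier X" using assms by (auto simp: polar_def)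
  have "\<one> \<otimes> \<one> \<preceq> c \<otimes> d" using assms cd by (intro le_mult_mono) auto
  then show 1: "\<one> \<preceq> c \<otimes> d" by simp
  have "lmeet X (c \<otimes> d) (labs X s) = \<one>" if "s \<in> S" for s
    using assms cd that
    by (intro lmeet_mult_eq_one) (auto simp: polar_def labs_of_ge_one labs_closed one_le_labs)
  then show "c \<otimes> d \<in> polar X S" using cd 1 by (simp add: polar_def labs_of_ge_one)
qed

text \<open>Reduces to the positive case: |x| |y| |x| lies in the polar and dominates
  \<open>x y\<close> and its inverse, so convexity applies.\<close>

lemma polar_mult:
  assumes xy: "x \<in> polar X S" "y \<in> polar X S" and S: "S \<subseteq> carrier X"
  shows "x \<otimes> y \<in> polar X S"
proof -
  have car: "x \<in> carrier X" "y \<in> carrier X" using xy by (auto simp: polar_def)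
  let ?c = "labs X x \<otimes> labs X y \<otimes> labs X x"
  have c: "?c \<in> polar X S" "\<one> \<preceq> ?c"
    using assms car by (auto intro!: polar_mult_ge_one polar_labs one_le_labs)
  have le: "labs X (x \<otimes> y) \<preceq> ?c" using car by (rule mult_le_labs_mult_labs)
  have "x \<otimes> y \<preceq> ?c"
    using le le_labs[of "x \<otimes> y"] car by (meson le_trans labs_closed m_closed)
  moreover have "inv (x \<otimes> y) \<preceq> ?c"
    using le inv_le_labs[of "x \<otimes> y"] car by (meson le_trans labs_closed m_closed inv_closed)
  ultimately show ?thesis using c car S by (simp add: polarI_le[of ?c])
qed

lemma polar_inv: "x \<in> polar X S \<Longrightarrow> inv x \<in> polar X S"
  by (simp add: polar_def labs_inv)

lemma polar_one:
  assumes "S \<subseteq> carrier X"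
  shows "\<one> \<in> polar X S"
proof -
  have "lmeet X \<one> (labs X s) = \<one>" if "s \<in> S" for s
    using that assms
    by (intro le_antisym lmeet_lb1 lmeet_greatest one_le_labs le_refl)
      (auto simp: labs_closed lmeet_closed)
  then show ?thesis by (simp add: polar_def labs_of_ge_one le_refl)
qed

lemma polar_conj:
  assumes x: "x \<in> polar X S" and g: "g \<in> carrier X" and S: "S \<subseteq> carrier X"
    and normal: "\<And>s. s \<in> S \<Longrightarrow> inv g \<otimes> s \<otimes> g \<in> S"
  shows "g \<otimes> x \<otimes> inv g \<in> polar X S"
proof -
  have xc: "x \<in> carrier X" using x by (simp add: polar_def)
  have "lmeet X (labs X (g \<otimes> x \<otimes> inv g)) (labs X s) = \<one>" if s: "s \<in> S" for s
  proof -
    \<comment> \<open>\<open>?t\<close> is the preimage of s under conjugation by g. Thus the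
      condition to be shown for s is the conjugate by g of the known condition for
      \<open>?t\<close>.\<close>
    let ?t = "inv g \<otimes> s \<otimes> g"
    have sc: "s \<in> carrier X" using s S by auto
    have t: "?t \<in> S" using normal s .
    have "g \<otimes> ?t \<otimes> inv g = s" using g sc by (simp add: m_assoc[symmetric]) (simp add: m_assoc)
    then have "labs X s = g \<otimes> labs X ?t \<otimes> inv g"
      using conj_labs[of g ?t] g sc by simp
    moreover have "lmeet X (labs X x) (labs X ?t) = \<one>" using x t by (simp add: polar_def)
    ultimately show ?thesis
      using conj_lmeet[of g "labs X x" "labs X ?t"] conj_labs[of g x] g xc sc
      by (simp add: labs_closed)
  qed
  then show ?thesis using xc g by (simp add: polar_def)
qed

text \<open>Shows that congruence modulo the polar respects joins. With a and b the absolute values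
  of the two quotients, the new quotient and its inverse both lie below \<open>a b\<close>, a
  positive element of the polar, so convexity applies.\<close>

lemma polar_ljoin_quotient:
  assumes S: "S \<subseteq> carrier X"
    and car: "x \<in> carrier X" "y \<in> carrier X" "x' \<in> carrier X" "y' \<in> carrier X"
    and d: "x \<otimes> inv y \<in> polar X S" "x' \<otimes> inv y' \<in> polar X S"
  shows "(x \<squnion>\<^sub>\<ell> x') \<otimes> inv (y \<squnion>\<^sub>\<ell> y') \<in> polar X S"
proof -
  define a b where "a = labs X (x \<otimes> inv y)" and "b = labs X (x' \<otimes> inv y')"
  have ab: "a \<in> carrier X" "b \<in> carrier X" using car by (auto simp: a_def b_def labs_closed)
  have ab1: "\<one> \<preceq> a" "\<one> \<preceq> b" using car by (auto simp: a_def b_def one_le_labs)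
  have "a \<in> polar X S" "b \<in> polar X S" using d by (auto simp: a_def b_def polar_labs)
  then have c: "a \<otimes> b \<in> polar X S" "\<one> \<preceq> a \<otimes> b"
    using ab1 S by (auto intro: polar_mult_ge_one)
  have "a \<otimes> \<one> \<preceq> a \<otimes> b" "\<one> \<otimes> b \<preceq> a \<otimes> b"
    using ab ab1 by (intro le_mult_mono le_refl; simp)+
  then have le: "a \<preceq> a \<otimes> b" "b \<preceq> a \<otimes> b" using ab by auto
  have shift: "u \<preceq> (a \<otimes> b) \<otimes> v"
    if "u \<otimes> inv v \<preceq> a \<otimes> b" "u \<in> carrier X" "v \<in> carrier X" for u v
  proof -
    have "u \<otimes> inv v \<otimes> v \<preceq> (a \<otimes> b) \<otimes> v" using that ab by (intro le_mult_right) auto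
    then show ?thesis using that by (simp add: m_assoc)
  qed
  \<comment> \<open>Each numerator lies below \<open>a b\<close> times its own denominator, hence
    below \<open>a b\<close> times the join of the denominators; so does the join of the numerators.
    The variables are generic because the bound is used for the quotient and for its
    inverse.\<close>
  have quot: "(u \<squnion>\<^sub>\<ell> u') \<otimes> inv (v \<squnion>\<^sub>\<ell> v') \<preceq> a \<otimes> b"
    if uv: "u \<in> carrier X" "v \<in> carrier X" "u' \<in> carrier X" "v' \<in> carrier X"
      and "u \<otimes> inv v \<preceq> a" "u' \<otimes> inv v' \<preceq> b" for u v u' v'
  proof -
    have w: "v \<squnion>\<^sub>\<ell> v' \<in> carrier X" "u \<squnion>\<^sub>\<ell> u' \<in> carrier X" using uv by (auto simp: ljoin_closed)
    have "u \<preceq> (a \<otimes> b) \<otimes> v" "u' \<preceq> (a \<otimes> b) \<otimes> v'"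
      using that le ab by (meson shift le_trans m_closed inv_closed)+
    moreover have "(a \<otimes> b) \<otimes> v \<preceq> (a \<otimes> b) \<otimes> (v \<squnion>\<^sub>\<ell> v')" "(a \<otimes> b) \<otimes> v' \<preceq> (a \<otimes> b) \<otimes> (v \<squnion>\<^sub>\<ell> v')"
      using uv ab by (auto intro!: le_mult_left ljoin_ub1 ljoin_ub2 ljoin_closed)
    ultimately have "u \<squnion>\<^sub>\<ell> u' \<preceq> (a \<otimes> b) \<otimes> (v \<squnion>\<^sub>\<ell> v')"
      using uv ab w by (meson ljoin_least le_trans m_closed)
    then have "(u \<squnion>\<^sub>\<ell> u') \<otimes> inv (v \<squnion>\<^sub>\<ell> v') \<preceq> (a \<otimes> b) \<otimes> (v \<squnion>\<^sub>\<ell> v') \<otimes> inv (v \<squnion>\<^sub>\<ell> v')"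
      using ab w by (intro le_mult_right) auto
    then show ?thesis using ab w by (simp add: m_assoc)
  qed
  have "x \<otimes> inv y \<preceq> a" "x' \<otimes> inv y' \<preceq> b"
    using car by (auto simp: a_def b_def le_labs)
  then have 1: "(x \<squnion>\<^sub>\<ell> x') \<otimes> inv (y \<squnion>\<^sub>\<ell> y') \<preceq> a \<otimes> b"
    using car by (intro quot)
  \<comment> \<open>Absolute values bound the inverse quotients too, so \<open>quot\<close> applies
    again with numerators and denominators exchanged.\<close>
  have "y \<otimes> inv x \<preceq> a" "y' \<otimes> inv x' \<preceq> b"
    using inv_le_labs[of "x \<otimes> inv y"] inv_le_labs[of "x' \<otimes> inv y'"] car
    by (auto simp: a_def b_def inv_mult_group)
  then have "(y \<squnion>\<^sub>\<ell> y') \<otimes> inv (x \<squnion>\<^sub>\<ell> x') \<preceq> a \<otimes> b"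
    using car by (intro quot)
  then have 2: "inv ((x \<squnion>\<^sub>\<ell> x') \<otimes> inv (y \<squnion>\<^sub>\<ell> y')) \<preceq> a \<otimes> b"
    using car by (simp add: inv_mult_group ljoin_closed)
  show ?thesis using c 1 2 car S by (simp add: polarI_le[of "a \<otimes> b"] ljoin_closed)
qed

section \<open>The product algebra, internal equivalence relations and their ideals\<close>

lemma carrier_lgroup_prod: "carrier (X \<times>\<^sub>\<ell> X) = carrier X \<times> carrier X"
  by (simp add: lgroup_prod_def)

lemma mult_lgroup_prod: "(x, y) \<otimes>\<^bsub>X \<times>\<^sub>\<ell> X\<^esub> (x', y') = (x \<otimes> x', y \<otimes> y')"
  by (simp add: lgroup_prod_def)

lemma one_lgroup_prod: "\<one>\<^bsub>X \<times>\<^sub>\<ell> X\<^esub> = (\<one>, \<one>)"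
  by (simp add: lgroup_prod_def)

lemma ljoin_lgroup_prod: "(x, y) \<squnion>\<^sub>\<ell>\<^bsub>X \<times>\<^sub>\<ell> X\<^esub> (x', y') = (x \<squnion>\<^sub>\<ell> x', y \<squnion>\<^sub>\<ell> y')"
  by (simp add: lgroup_prod_def)

lemmas lgroup_prod_simps =
  carrier_lgroup_prod mult_lgroup_prod one_lgroup_prod ljoin_lgroup_prod

lemma group_lgroup_prod: "group (X \<times>\<^sub>\<ell> X)"
proof (rule groupI)
  fix p assume "p \<in> carrier (X \<times>\<^sub>\<ell> X)"
  then show "\<exists>q\<in>carrier (X \<times>\<^sub>\<ell> X). q \<otimes>\<^bsub>X \<times>\<^sub>\<ell> X\<^esub> p = \<one>\<^bsub>X \<times>\<^sub>\<ell> X\<^esub>"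
    by (intro bexI[of _ "(inv (fst p), inv (snd p))"]) (auto simp: lgroup_prod_simps)
qed (auto simp: lgroup_prod_simps m_assoc)

lemma inv_lgroup_prod:
  "\<lbrakk>x \<in> carrier X; y \<in> carrier X\<rbrakk> \<Longrightarrow> inv\<^bsub>X \<times>\<^sub>\<ell> X\<^esub> (x, y) = (inv x, inv y)"
  by (intro group.inv_equality[OF group_lgroup_prod]) (auto simp: lgroup_prod_simps)

context
  fixes R assumes R: "R \<in> internal_equivs X"
begin

lemma internal_equiv_closed: "(x, y) \<in> R \<Longrightarrow> x \<in> carrier X \<and> y \<in> carrier X"
  using R by (auto simp: internal_equivs_def lsubalgebra_def lgroup_prod_simps
      dest!: subgroup.subset)

lemma internal_equiv_refl: "x \<in> carrier X \<Longrightarrow> (x, x) \<in> R"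
  using R by (auto simp: internal_equivs_def equiv_def refl_on_def)

lemma internal_equiv_sym: "(x, y) \<in> R \<Longrightarrow> (y, x) \<in> R"
  using R by (auto simp: internal_equivs_def equiv_def sym_def)

lemma internal_equiv_trans: "(x, y) \<in> R \<Longrightarrow> (y, z) \<in> R \<Longrightarrow> (x, z) \<in> R"
  using R by (auto simp: internal_equivs_def equiv_def trans_def)

lemma internal_equiv_mult: "(x, y) \<in> R \<Longrightarrow> (x', y') \<in> R \<Longrightarrow> (x \<otimes> x', y \<otimes> y') \<in> R"
  using R subgroup.m_closed[of R "X \<times>\<^sub>\<ell> X" "(x, y)" "(x', y')"]
  by (auto simp: internal_equivs_def lsubalgebra_def lgroup_prod_simps)

lemma internal_equiv_ljoin: "(x, y) \<in> R \<Longrightarrow> (x', y') \<in> R \<Longrightarrow> (x \<squnion>\<^sub>\<ell> x', y \<squnion>\<^sub>\<ell> y') \<in> R"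
  using R ljoin_lgroup_prod[of x y x' y']
  by (fastforce simp: internal_equivs_def lsubalgebra_def)

lemma internal_equiv_inv: "(x, y) \<in> R \<Longrightarrow> (inv x, inv y) \<in> R"
  using R subgroup.m_inv_closed[of R "X \<times>\<^sub>\<ell> X" "(x, y)"] internal_equiv_closed[of x y]
  by (auto simp: internal_equivs_def lsubalgebra_def inv_lgroup_prod)

text \<open>Multiplying by the reflexive pairs of \<open>inv y\<close> and of y translates between a
  pair and its quotient, so a relation can be recovered from its ideal.\<close>

lemma internal_equiv_iff:
  assumes "x \<in> carrier X" "y \<in> carrier X"
  shows "(x, y) \<in> R \<longleftrightarrow> x \<otimes> inv y \<in> assoc_ideal X R"
proof
  assume "(x, y) \<in> R"
  then have "(x \<otimes> inv y, y \<otimes> inv y) \<in> R"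
    using assms by (intro internal_equiv_mult internal_equiv_refl) auto
  then show "x \<otimes> inv y \<in> assoc_ideal X R" using assms by (simp add: assoc_ideal_def)
next
  assume "x \<otimes> inv y \<in> assoc_ideal X R"
  then have "(x \<otimes> inv y \<otimes> y, \<one> \<otimes> y) \<in> R"
    using assms by (intro internal_equiv_mult internal_equiv_refl) (auto simp: assoc_ideal_def)
  then show "(x, y) \<in> R" using assms by (simp add: m_assoc)
qed

text \<open>Provides the normality that \<open>polar_conj\<close> requires of the underlying
  set.\<close>

lemma assoc_ideal_conj:
  assumes "i \<in> assoc_ideal X R" "g \<in> carrier X"
  shows "g \<otimes> i \<otimes> inv g \<in> assoc_ideal X R"
proof -
  have "(g \<otimes> i \<otimes> inv g, g \<otimes> \<one> \<otimes> inv g) \<in> R"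
    using assms by (intro internal_equiv_mult internal_equiv_refl) (auto simp: assoc_ideal_def)
  then show ?thesis using assms by (auto simp: assoc_ideal_def)
qed

lemma assoc_ideal_labs:
  assumes "i \<in> assoc_ideal X R"
  shows "labs X i \<in> assoc_ideal X R"
proof -
  have i: "i \<in> carrier X" "(i, \<one>) \<in> R" using assms by (auto simp: assoc_ideal_def)
  then have "(i \<squnion>\<^sub>\<ell> inv i, \<one> \<squnion>\<^sub>\<ell> inv \<one>) \<in> R"
    using internal_equiv_ljoin internal_equiv_inv by blast
  then show ?thesis using i by (simp add: assoc_ideal_def labs_def ljoin_idem ljoin_closed)
qed

end

text \<open>Makes \<open>assoc_ideal_inv\<close> a left inverse of \<open>assoc_ideal\<close> on
  internal equivalence relations, so it can be evaluated at an ideal by exhibiting a relation with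
  that ideal.\<close>

lemma inj_on_assoc_ideal: "inj_on (assoc_ideal X) (internal_equivs X)"
proof (rule inj_onI)
  fix R S assume R: "R \<in> internal_equivs X" and S: "S \<in> internal_equivs X"
    and eq: "assoc_ideal X R = assoc_ideal X S"
  have "(x, y) \<in> R \<longleftrightarrow> (x, y) \<in> S" for x y
    using internal_equiv_iff[OF R, of x y] internal_equiv_iff[OF S, of x y]
      internal_equiv_closed[OF R, of x y] internal_equiv_closed[OF S, of x y] eq by blast
  then show "R = S" by auto
qed

section \<open>The congruence modulo the polar\<close>

definition polar_cong :: "('a \<times> 'a) set \<Rightarrow> ('a \<times> 'a) set" where
  "polar_cong R = {(x, y). x \<in> carrier X \<and> y \<in> carrier X \<and> x \<otimes> inv y \<in> polar X (assoc_ideal X R)}"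

lemma assoc_ideal_polar_cong: "assoc_ideal X (polar_cong R) = polar X (assoc_ideal X R)"
proof (rule Set.set_eqI)
  fix x
  have "(x, \<one>) \<in> polar_cong R \<longleftrightarrow> x \<in> polar X (assoc_ideal X R)" if "x \<in> carrier X"
    using that by (simp add: polar_cong_def)
  then show "x \<in> assoc_ideal X (polar_cong R) \<longleftrightarrow> x \<in> polar X (assoc_ideal X R)"
    unfolding assoc_ideal_def[of X "polar_cong R"] by (blast dest: polar_closed)
qed

lemma polar_cong_internal_equiv:
  assumes R: "R \<in> internal_equivs X"
  shows "polar_cong R \<in> internal_equivs X"
proof -
  let ?C = "polar_cong R" and ?J = "polar X (assoc_ideal X R)"
  have I: "assoc_ideal X R \<subseteq> carrier X" by (auto simp: assoc_ideal_def)
  \<comment> \<open>\<open>polar_conj\<close> asks for stability of the ideal under s ->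
    \<open>g^-1 s g\<close>, which is \<open>assoc_ideal_conj\<close> at
    \<open>inv g\<close>.\<close>
  have conj: "g \<otimes> x \<otimes> inv g \<in> ?J" if "x \<in> ?J" "g \<in> carrier X" for g x
    using polar_conj[OF that I] assoc_ideal_conj[OF R, of _ "inv g"] that by simp
  have refl: "(x, x) \<in> ?C" if "x \<in> carrier X" for x
    using that polar_one[OF I] by (simp add: polar_cong_def)
  have sym: "(y, x) \<in> ?C" if "(x, y) \<in> ?C" for x y
    using that polar_inv[of "x \<otimes> inv y"] by (auto simp: polar_cong_def inv_mult_group)
  have trans: "(x, z) \<in> ?C" if "(x, y) \<in> ?C" "(y, z) \<in> ?C" for x y z
  proof -
    have car: "x \<in> carrier X" "y \<in> carrier X" "z \<in> carrier X"
      using that by (auto simp: polar_cong_def)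
    have "(x \<otimes> inv y) \<otimes> (y \<otimes> inv z) \<in> ?J"
      using that by (intro polar_mult[OF _ _ I, of "x \<otimes> inv y" "y \<otimes> inv z"]) (simp_all add: polar_cong_def)
    moreover have "(x \<otimes> inv y) \<otimes> (y \<otimes> inv z) = x \<otimes> inv z"
      using car by (metis inv_closed inv_solve_left m_assoc m_closed)
    ultimately show ?thesis using car by (simp add: polar_cong_def)
  qed
  have sub: "?C \<subseteq> carrier X \<times> carrier X" by (auto simp: polar_cong_def)
  have equiv: "equiv (carrier X) ?C"
    using sub refl sym trans unfolding equiv_def refl_on_def sym_def trans_def by blast
  have mult: "(x \<otimes> x', y \<otimes> y') \<in> ?C" if "(x, y) \<in> ?C" "(x', y') \<in> ?C" for x y x' y'
  proof -
    have car: "x \<in> carrier X" "y \<in> carrier X" "x' \<in> carrier X" "y' \<in> carrier X"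
      using that by (auto simp: polar_cong_def)
    \<comment> \<open>The quotient of \<open>x x'\<close> by \<open>y y'\<close> factors as a
      conjugate of \<open>x' y'^-1\<close> times \<open>x y^-1\<close>; normality handles the first
      factor.\<close>
    have "(x \<otimes> (x' \<otimes> inv y') \<otimes> inv x) \<otimes> (x \<otimes> inv y) \<in> ?J"
      using that car by (intro polar_mult[OF conj _ I, of _ _ "x \<otimes> inv y"]) (simp_all add: polar_cong_def)
    moreover have "(x \<otimes> (x' \<otimes> inv y') \<otimes> inv x) \<otimes> (x \<otimes> inv y) = x \<otimes> x' \<otimes> inv (y \<otimes> y')"
    proof -
      have "inv x \<otimes> (x \<otimes> inv y) = inv y" using car by (simp add: m_assoc[symmetric])
      then show ?thesis using car by (simp add: m_assoc inv_mult_group)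
    qed
    ultimately show ?thesis using car by (simp add: polar_cong_def)
  qed
  have inv: "(inv x, inv y) \<in> ?C" if "(x, y) \<in> ?C" for x y
  proof -
    have car: "x \<in> carrier X" "y \<in> carrier X" using that by (auto simp: polar_cong_def)
    \<comment> \<open>Conjugating \<open>y x^-1\<close> by \<open>x^-1\<close> gives
      \<open>x^-1 y\<close>, the quotient of the two inverses.\<close>
    have "inv x \<otimes> (y \<otimes> inv x) \<otimes> inv (inv x) \<in> ?J"
      using sym[OF that] car by (intro conj) (auto simp: polar_cong_def)
    then show ?thesis using car by (simp add: polar_cong_def m_assoc)
  qed
  have "subgroup ?C (X \<times>\<^sub>\<ell> X)"
  proof (rule group.subgroupI[OF group_lgroup_prod])
    show "?C \<subseteq> carrier (X \<times>\<^sub>\<ell> X)" by (auto simp: polar_cong_def lgroup_prod_simps)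
    show "?C \<noteq> {}" using refl one_closed by blast
    show "inv\<^bsub>X \<times>\<^sub>\<ell> X\<^esub> p \<in> ?C" if "p \<in> ?C" for p
      using that inv by (cases p) (auto simp: inv_lgroup_prod polar_cong_def)
    show "p \<otimes>\<^bsub>X \<times>\<^sub>\<ell> X\<^esub> q \<in> ?C" if "p \<in> ?C" "q \<in> ?C" for p q
      using that mult by (cases p; cases q) (simp add: lgroup_prod_simps)
  qed
  moreover have "p \<squnion>\<^sub>\<ell>\<^bsub>X \<times>\<^sub>\<ell> X\<^esub> q \<in> ?C" if "p \<in> ?C" "q \<in> ?C" for p q
    using that I by (cases p; cases q)
      (auto simp: lgroup_prod_simps polar_cong_def ljoin_closed intro: polar_ljoin_quotient)
  ultimately show ?thesis using equiv by (simp add: internal_equivs_def lsubalgebra_def)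
qed

text \<open>The quotient d of x by y lies both in the ideal and in its polar, so |d| = |d| meet |d|
  = e, which forces d = e.\<close>

lemma inter_polar_cong_subset_Id:
  assumes R: "R \<in> internal_equivs X" and "(x, y) \<in> R" "(x, y) \<in> polar_cong R"
  shows "x = y"
proof -
  have car: "x \<in> carrier X" "y \<in> carrier X" using assms by (auto simp: polar_cong_def)
  let ?d = "x \<otimes> inv y"
  have "?d \<in> assoc_ideal X R" using internal_equiv_iff[OF R] car assms by simp
  moreover have "?d \<in> polar X (assoc_ideal X R)" using assms by (simp add: polar_cong_def)
  ultimately have "lmeet X (labs X ?d) (labs X ?d) = \<one>" by (simp add: polar_def)
  then have "labs X ?d = \<one>" using car by (simp add: lmeet_idem labs_closed)
  then have "?d = \<one>" using car by (simp add: labs_eq_one)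
  then show ?thesis using car by (metis inv_equality inv_inv inv_closed)
qed

section \<open>The pullback and the connector of two relations\<close>

definition rel_pullback :: "('a \<times> 'a) set \<Rightarrow> ('a \<times> 'a) set \<Rightarrow> (('a \<times> 'a) \<times> ('a \<times> 'a)) lgroup" where
  "rel_pullback R S = lgroup_pullback (rel_lgroup X R) (rel_lgroup X S) snd fst"

lemma carrier_rel_pullback:
  "((x, y), (u, z)) \<in> carrier (rel_pullback R S) \<longleftrightarrow> (x, y) \<in> R \<and> (u, z) \<in> S \<and> y = u"
  by (simp add: rel_pullback_def lgroup_pullback_def rel_lgroup_def)

lemma mult_rel_pullback:
  "((x, y), (u, z)) \<otimes>\<^bsub>rel_pullback R S\<^esub> ((x', y'), (u', z')) =
    ((x \<otimes> x', y \<otimes> y'), (u \<otimes> u', z \<otimes> z'))"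
  by (simp add: rel_pullback_def lgroup_pullback_def rel_lgroup_def lgroup_prod_def)

lemma ljoin_rel_pullback:
  "((x, y), (u, z)) \<squnion>\<^sub>\<ell>\<^bsub>rel_pullback R S\<^esub> ((x', y'), (u', z')) =
    ((x \<squnion>\<^sub>\<ell> x', y \<squnion>\<^sub>\<ell> y'), (u \<squnion>\<^sub>\<ell> u', z \<squnion>\<^sub>\<ell> z'))"
  by (simp add: rel_pullback_def lgroup_pullback_def rel_lgroup_def lgroup_prod_def)

text \<open>The Mal'tsev operation of the group, made extensional on the pullback so that it can be
  compared with elements of \<open>lgroup_hom\<close>.\<close>

definition connector :: "('a \<times> 'a) set \<Rightarrow> ('a \<times> 'a) set \<Rightarrow> ('a \<times> 'a) \<times> ('a \<times> 'a) \<Rightarrow> 'a" where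
  "connector R S = restrict (\<lambda>((x, y), (u, z)). x \<otimes> inv y \<otimes> z) (carrier (rel_pullback R S))"

text \<open>Every element ((x, y), (y, z)) is the product of ((\<open>x y^-1\<close>, e), (e, e))
  and ((y, y), (y, z)). These factors are values of the two sections of the pullback, where p is
  prescribed, so multiplicativity determines p.\<close>

lemma connector_unique:
  assumes R: "R \<in> internal_equivs X" and S: "S \<in> internal_equivs X"
    and p: "p \<in> lgroup_hom (rel_pullback R S) X"
    and pS: "\<forall>s\<in>S. p ((fst s, fst s), s) = snd s"
    and pR: "\<forall>r\<in>R. p (r, (snd r, snd r)) = fst r"
  shows "p = connector R S"
proof (rule extensionalityI)
  show "p \<in> extensional (carrier (rel_pullback R S))" using p by (simp add: lgroup_hom_def)
  show "connector R S \<in> extensional (carrier (rel_pullback R S))" by (simp add: connector_def)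
  fix q assume q: "q \<in> carrier (rel_pullback R S)"
  then obtain x y z where q_eq: "q = ((x, y), (y, z))" and xy: "(x, y) \<in> R" and yz: "(y, z) \<in> S"
    by (metis carrier_rel_pullback surj_pair)
  have car: "x \<in> carrier X" "y \<in> carrier X" "z \<in> carrier X"
    using xy yz internal_equiv_closed[OF R] internal_equiv_closed[OF S] by auto
  have R1: "(x \<otimes> inv y, \<one>) \<in> R"
    using xy internal_equiv_iff[OF R car(1,2)] by (simp add: assoc_ideal_def)
  have "q = ((x \<otimes> inv y, \<one>), (\<one>, \<one>)) \<otimes>\<^bsub>rel_pullback R S\<^esub> ((y, y), (y, z))"
    using car by (simp add: q_eq mult_rel_pullback m_assoc)
  moreover have "((x \<otimes> inv y, \<one>), (\<one>, \<one>)) \<in> carrier (rel_pullback R S)"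
    "((y, y), (y, z)) \<in> carrier (rel_pullback R S)"
    using R1 yz car internal_equiv_refl[OF R] internal_equiv_refl[OF S]
    by (auto simp: carrier_rel_pullback)
  ultimately have "p q = p ((x \<otimes> inv y, \<one>), (\<one>, \<one>)) \<otimes> p ((y, y), (y, z))"
    using p by (simp add: lgroup_hom_def hom_mult)
  also have "\<dots> = x \<otimes> inv y \<otimes> z" using pS pR R1 yz by force
  also have "\<dots> = connector R S q" using q by (simp add: connector_def q_eq)
  finally show "p q = connector R S q" .
qed

lemma connector_eq:
  "(x, y) \<in> R \<Longrightarrow> (y, z) \<in> S \<Longrightarrow> connector R S ((x, y), (y, z)) = x \<otimes> inv y \<otimes> z"
  by (simp add: connector_def carrier_rel_pullback)

text \<open>The connector always satisfies the two section equations and is the only candidate, so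
  commutation amounts to its preserving the operations.\<close>

lemma smith_pedicchio_commute_iff:
  assumes R: "R \<in> internal_equivs X" and S: "S \<in> internal_equivs X"
  shows "smith_pedicchio_commute X R S \<longleftrightarrow> connector R S \<in> lgroup_hom (rel_pullback R S) X"
proof
  assume "smith_pedicchio_commute X R S"
  then show "connector R S \<in> lgroup_hom (rel_pullback R S) X"
    unfolding smith_pedicchio_commute_def rel_pullback_def[symmetric]
    using connector_unique[OF R S] by metis
next
  assume hom: "connector R S \<in> lgroup_hom (rel_pullback R S) X"
  have S': "connector R S ((fst s, fst s), s) = snd s" if "s \<in> S" for s
    using that internal_equiv_closed[OF S, of "fst s" "snd s"]
      internal_equiv_refl[OF R, of "fst s"] connector_eq[of "fst s" "fst s" R "snd s" S] by simp
  have R': "connector R S (r, (snd r, snd r)) = fst r" if "r \<in> R" for r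
    using that internal_equiv_closed[OF R, of "fst r" "snd r"]
      internal_equiv_refl[OF S, of "snd r"] connector_eq[of "fst r" "snd r" R "snd r" S]
    by (simp add: m_assoc)
  show "smith_pedicchio_commute X R S"
    unfolding smith_pedicchio_commute_def rel_pullback_def[symmetric]
    using hom S' R' connector_unique[OF R S] by blast
qed

text \<open>Replacing x by its R-class mate y in \<open>x y^-1 z\<close> leaves z, and replacing z
  by its S-class mate y leaves x.\<close>

lemma connector_cong:
  assumes R: "R \<in> internal_equivs X" and S: "S \<in> internal_equivs X"
    and "(x, y) \<in> R" "(y, z) \<in> S"
  shows "(connector R S ((x, y), (y, z)), z) \<in> R" "(connector R S ((x, y), (y, z)), x) \<in> S"
proof -
  have car: "x \<in> carrier X" "y \<in> carrier X" "z \<in> carrier X"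
    using assms internal_equiv_closed[OF R] internal_equiv_closed[OF S] by auto
  have "(x \<otimes> inv y \<otimes> z, y \<otimes> inv y \<otimes> z) \<in> R"
    using assms car by (intro internal_equiv_mult internal_equiv_refl) auto
  moreover have "(x \<otimes> inv y \<otimes> z, x \<otimes> inv y \<otimes> y) \<in> S"
    using assms car internal_equiv_sym[OF S] by (intro internal_equiv_mult internal_equiv_refl) auto
  ultimately show "(connector R S ((x, y), (y, z)), z) \<in> R"
    "(connector R S ((x, y), (y, z)), x) \<in> S"
    using assms car by (auto simp: connector_eq m_assoc)
qed

section \<open>Commutation and the centralizer\<close>

lemma commute_if_inter_subset_Id:
  assumes R: "R \<in> internal_equivs X" and S: "S \<in> internal_equivs X" and Id: "R \<inter> S \<subseteq> Id"
  shows "smith_pedicchio_commute X R S"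
proof -
  let ?P = "rel_pullback R S" and ?p = "connector R S"
  note cong = connector_cong[OF R S]
  \<comment> \<open>An element is determined by its R-class together with its S-class, so equations
    can be checked modulo R and modulo S.\<close>
  have unique: "s = t" if "(s, z) \<in> R" "(t, z) \<in> R" "(s, x) \<in> S" "(t, x) \<in> S" for s t x z
    using that Id internal_equiv_sym[OF R] internal_equiv_trans[OF R]
      internal_equiv_sym[OF S] internal_equiv_trans[OF S] by blast
  \<comment> \<open>Both sides of the product equation are R-related to \<open>z z'\<close> and
    S-related to \<open>x x'\<close>; likewise with joins in the second equation.\<close>
  have pres: "?p (((x, y), (y, z)) \<otimes>\<^bsub>?P\<^esub> ((x', y'), (y', z'))) =
        ?p ((x, y), (y, z)) \<otimes> ?p ((x', y'), (y', z'))"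
      "?p (((x, y), (y, z)) \<squnion>\<^sub>\<ell>\<^bsub>?P\<^esub> ((x', y'), (y', z'))) =
        ?p ((x, y), (y, z)) \<squnion>\<^sub>\<ell> ?p ((x', y'), (y', z'))"
    if "(x, y) \<in> R" "(y, z) \<in> S" "(x', y') \<in> R" "(y', z') \<in> S" for x y z x' y' z'
    unfolding mult_rel_pullback ljoin_rel_pullback
    by (rule unique[of _ "z \<otimes> z'" _ "x \<otimes> x'"] unique[of _ "z \<squnion>\<^sub>\<ell> z'" _ "x \<squnion>\<^sub>\<ell> x'"];
        intro cong internal_equiv_mult[OF R] internal_equiv_mult[OF S]
          internal_equiv_ljoin[OF R] internal_equiv_ljoin[OF S] that)+
  have elim: "\<exists>x y z. q = ((x, y), (y, z)) \<and> (x, y) \<in> R \<and> (y, z) \<in> S" if "q \<in> carrier ?P" for q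
    using that by (metis carrier_rel_pullback surj_pair)
  have "?p q \<in> carrier X" if q: "q \<in> carrier ?P" for q
    using elim[OF q] cong internal_equiv_closed[OF R] by blast
  moreover have "?p (q \<otimes>\<^bsub>?P\<^esub> q') = ?p q \<otimes> ?p q' \<and> ?p (q \<squnion>\<^sub>\<ell>\<^bsub>?P\<^esub> q') = ?p q \<squnion>\<^sub>\<ell> ?p q'"
    if "q \<in> carrier ?P" "q' \<in> carrier ?P" for q q'
    using elim[OF that(1)] elim[OF that(2)] pres by blast
  moreover have "?p \<in> extensional (carrier ?P)" by (simp add: connector_def)
  ultimately have "?p \<in> lgroup_hom ?P X" by (auto simp: lgroup_hom_def hom_def)
  then show ?thesis using smith_pedicchio_commute_iff[OF R S] by simp
qed

lemma assoc_ideal_subset_polar_if_commute: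
  assumes R: "R \<in> internal_equivs X" and S: "S \<in> internal_equivs X"
    and comm: "smith_pedicchio_commute X R S"
  shows "assoc_ideal X S \<subseteq> polar X (assoc_ideal X R)"
proof
  fix k assume k: "k \<in> assoc_ideal X S"
  have "lmeet X (labs X k) (labs X i) = \<one>" if i: "i \<in> assoc_ideal X R" for i
  proof -
    \<comment> \<open>Absolute values stay in the respective ideals and are positive, and their meet
      is exactly the one in the polar condition.\<close>
    define a b where "a = labs X i" and "b = labs X k"
    let ?P = "rel_pullback R S" and ?p = "connector R S"
    have car: "a \<in> carrier X" "b \<in> carrier X"
      using i k by (auto simp: assoc_ideal_def a_def b_def labs_closed)
    have ge: "a \<squnion>\<^sub>\<ell> \<one> = a" "\<one> \<squnion>\<^sub>\<ell> b = b"
      using one_le_labs[of i] one_le_labs[of k] i k car ljoin_comm[of a \<one>]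
      by (auto simp: le_def assoc_ideal_def a_def b_def)
    have a: "(a, \<one>) \<in> R" using assoc_ideal_labs[OF R i] by (simp add: assoc_ideal_def a_def)
    have b: "(\<one>, b) \<in> S"
      using assoc_ideal_labs[OF S k] internal_equiv_sym[OF S] by (simp add: assoc_ideal_def b_def)
    have e: "(\<one>, \<one>) \<in> R" "(\<one>, \<one>) \<in> S"
      using internal_equiv_refl[OF R] internal_equiv_refl[OF S] by auto
    have "?p \<in> lgroup_hom ?P X" using comm smith_pedicchio_commute_iff[OF R S] by simp
    \<comment> \<open>By the absorptions in \<open>ge\<close>, the join on the left is ((a, e), (e,
      b)), where the connector takes the value \<open>a b\<close>; the two joined values on the
      right are a and b.\<close>
    then have "?p (((a, \<one>), (\<one>, \<one>)) \<squnion>\<^sub>\<ell>\<^bsub>?P\<^esub> ((\<one>, \<one>), (\<one>, b))) =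
        ?p ((a, \<one>), (\<one>, \<one>)) \<squnion>\<^sub>\<ell> ?p ((\<one>, \<one>), (\<one>, b))"
      using a b e by (simp add: lgroup_hom_def carrier_rel_pullback)
    then have "a \<otimes> b = a \<squnion>\<^sub>\<ell> b"
      using a b e car ge by (simp add: ljoin_rel_pullback connector_eq ljoin_idem)
    then have "lmeet X a b = \<one>" using car by (rule lmeet_eq_one_if_mult_eq_ljoin)
    then show ?thesis using car by (simp add: lmeet_def ljoin_comm a_def b_def)
  qed
  then show "k \<in> polar X (assoc_ideal X R)" using k by (simp add: polar_def assoc_ideal_def)
qed

lemma is_centralizer_polar_cong:
  assumes R: "R \<in> internal_equivs X"
  shows "is_centralizer X R (polar_cong R)"
  unfolding is_centralizer_def
proof (intro conjI ballI impI)
  show C: "polar_cong R \<in> internal_equivs X" using R by (rule polar_cong_internal_equiv)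
  show "smith_pedicchio_commute X R (polar_cong R)"
    using inter_polar_cong_subset_Id[OF R] by (intro commute_if_inter_subset_Id R C) auto
  fix S assume S: "S \<in> internal_equivs X" and "smith_pedicchio_commute X R S"
  then have "assoc_ideal X S \<subseteq> polar X (assoc_ideal X R)"
    using R by (intro assoc_ideal_subset_polar_if_commute)
  \<comment> \<open>The inclusion of ideals becomes an inclusion of relations by passing from each
    pair of S to its quotient.\<close>
  then show "S \<subseteq> polar_cong R"
    using internal_equiv_closed[OF S] internal_equiv_iff[OF S, THEN iffD1]
    unfolding polar_cong_def by blast
qed

end

theorem mainTheorem12:
  fixes X :: "('a, 'm) lgroup_scheme" and R :: "('a \<times> 'a) set"
  assumes "lattice_ordered_group X"
    and "R \<in> internal_equivs X"
  shows "\<exists>C. is_centralizer X R C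
           \<and> C = assoc_ideal_inv X (polar X (assoc_ideal X R))
           \<and> assoc_ideal X C = polar X (assoc_ideal X R)"
proof -
  interpret lattice_ordered_group X by fact
  \<comment> \<open>By injectivity, the inverse at the polar is the one internal equivalence
    relation whose ideal is the polar, and \<open>polar_cong R\<close> is such a relation.\<close>
  have "assoc_ideal_inv X (polar X (assoc_ideal X R)) = polar_cong R"
    unfolding assoc_ideal_inv_def using assms(2)
    by (intro the_inv_into_f_eq inj_on_assoc_ideal assoc_ideal_polar_cong
        polar_cong_internal_equiv)
  then show ?thesis
    using is_centralizer_polar_cong[OF assms(2)] assoc_ideal_polar_cong by metis
qed

end
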